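(* Let $\nu>0$, $\mu\ge0$, let $l\ge 0$ be the integer with $l+1>\frac{\mu+\sqrt{\mu^2+4\nu}}{2\nu}>l$, let $m=2l+1$, and let $N$ be an even integer with $N/2>l$. Let $K\in\mathbb{R}^{m\times m}$ be a matrix such that $A_u+B_uK$ has prescribed eigenvalues $\lambda_1,\dots,\lambda_m$, all with negative real part, and let $$BK=\begin{bmatrix}B_uK&0\\ B_sK&0\end{bmatrix}.$$ Let $\epsilon_1,\epsilon_2\in\mathbb{R}$ and $$\Delta=\operatorname{diag}\bigl(0,\,-\epsilon_1k^4+\epsilon_2k^3,\,-\epsilon_1k^4+\epsilon_2k^3\bigr)_{k=1,\dots,N/2}$$ (the entry $0$ followed, for each $k=1,\dots,N/2$, by the entry $-\epsilon_1k^4+\epsilon_2k^3$ repeated twice). Then the perturbed system matrix $A+BK+\Delta$ is stable provided that $$\Bigl(2\sum_{k=1}^{N/2}k^6\bigl(\epsilon_1^2k^2-2\epsilon_1\epsilon_2k+\epsilon_2^2\bigr)\Bigr)^{1/2}\le\min_{s=i\omega,\ \omega\in\mathbb{R}}\sigma_{\min}\bigl(sI-(A+BK)\bigr).$$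
   Context: A square matrix is stable if all its eigenvalues have negative real part. $\sigma_{\min}(M)$ denotes the smallest singular value of $M$. The matrices come from the Fourier truncation (modes $1$ and $\sin kx,\cos kx$ for $1\le k\le N/2$, hence $N+1$ unknowns) of the linearised controlled equation $u_t=-\nu u_{xxxx}-\mu\mathcal{H}[u_{xxx}]-u_{xx}+\sum_{i=1}^m b_i(x)f_i(t)$ on $2\pi$-periodic functions, where $\mathcal H$ is the Hilbert transform; $\epsilon_1,\epsilon_2$ are errors in $\nu,\mu$. Explicitly: $$A=\begin{bmatrix}A_u&0\\0&A_s\end{bmatrix},$$ $A_u=\operatorname{diag}(0,-\nu+\mu+1,-\nu+\mu+1,\dots,-\nu l^4+\mu l^3+l^2,-\nu l^4+\mu l^3+l^2)$ of size $2l+1$, and $A_s$ is the diagonal matrix with entries $-\nu k^4+\mu k^3+k^2$, each repeated twice, for $k=l+1,\dots,N/2$. $B_u$ ($(2l+1)\times m$) and $B_s$ ($(N-2l)\times m$) are the real matrices whose $i$-th columns are respectively $[b_{i0}^c\ b_{i1}^s\ b_{i1}^c\ \cdots\ b_{il}^s\ b_{il}^c]^T$ and $[b_{i(l+1)}^s\ b_{i(l+1)}^c\ \cdots\ b_{i(N/2)}^s\ b_{i(N/2)}^c]^T$, where $b_{ik}^s,b_{ik}^c$ are the sine and cosine Fourier coefficients of the $i$-th actuator function $b_i$ (a point actuator $b_i(x)=\delta(x-x_i)$ or a smooth approximation of it). *)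

theory Defs
  imports
    "HOL-Analysis.Analysis"
    "Jordan_Normal_Form.Schur_Decomposition"
    "Jordan_Normal_Form.Spectral_Radius"
begin

(* Real matrices are viewed as complex ones, so non-real eigenvalues are taken into account. *)
abbreviation cmat :: "real mat \<Rightarrow> complex mat" where
  "cmat M \<equiv> map_mat complex_of_real M"

definition stable_mat :: "real mat \<Rightarrow> bool" where
  "stable_mat M \<longleftrightarrow> square_mat M \<and> (\<forall>z. eigenvalue (cmat M) z \<longrightarrow> Re z < 0)"

(* "k 1, ..., k n" are the eigenvalues of M, listed with algebraic multiplicity. *)
definition has_eigenvalues :: "complex mat \<Rightarrow> nat \<Rightarrow> (nat \<Rightarrow> complex) \<Rightarrow> bool" where
  "has_eigenvalues M n k \<longleftrightarrow> char_poly M = (\<Prod>i=1..n. [:- k i, 1:])"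

(* Used for square matrices only. *)
definition singular_values :: "complex mat \<Rightarrow> real set" where
  "singular_values M =
     {\<sigma>. \<sigma> \<ge> 0 \<and> eigenvalue (mat_adjoint M * M) (complex_of_real (\<sigma>\<^sup>2))}"

definition sigma_min :: "complex mat \<Rightarrow> real" where
  "sigma_min M = Min (singular_values M)"

(* "Point x" is the Dirac distribution at x, repeated with period 2 pi. *)
datatype actuator = Point real | Smooth "real \<Rightarrow> real"

fun admissible_actuator :: "actuator \<Rightarrow> bool" where
  "admissible_actuator (Point x) = True"
| "admissible_actuator (Smooth g) =
     ((\<forall>n x. ((deriv ^^ n) g) differentiable (at x)) \<and> (\<forall>x. g (x + 2 * pi) = g x))"

(* Pairing, over one period, with a 2 pi-periodic test function. *)
fun pairing :: "actuator \<Rightarrow> (real \<Rightarrow> real) \<Rightarrow> real" where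
  "pairing (Point x) \<phi> = \<phi> x"
| "pairing (Smooth g) \<phi> = integral {0..2 * pi} (\<lambda>x. g x * \<phi> x)"

(* Coefficients of the expansion in the functions 1, sin (k x), cos (k x), as used to expand the
   solution. *)
definition sin_coeff :: "actuator \<Rightarrow> nat \<Rightarrow> real" where
  "sin_coeff b k = pairing b (\<lambda>x. sin (real k * x)) / pi"

definition cos_coeff :: "actuator \<Rightarrow> nat \<Rightarrow> real" where
  "cos_coeff b k =
     (if k = 0 then pairing b (\<lambda>x. 1) / (2 * pi) else pairing b (\<lambda>x. cos (real k * x)) / pi)"

(* The modes are numbered from 0 in the order 1, sin x, cos x, sin (2 x), cos (2 x), ...;
   the first 2 l + 1 of them form the block with subscript u, and the next N - 2 l the one with
   subscript s. *)
definition wavenumber :: "nat \<Rightarrow> nat" where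
  "wavenumber r = (r + 1) div 2"

definition mode_coeff :: "actuator \<Rightarrow> nat \<Rightarrow> real" where
  "mode_coeff b r =
     (if odd r then sin_coeff b (wavenumber r) else cos_coeff b (wavenumber r))"

definition growth_rate :: "real \<Rightarrow> real \<Rightarrow> nat \<Rightarrow> real" where
  "growth_rate \<nu> \<mu> k = - \<nu> * real k ^ 4 + \<mu> * real k ^ 3 + real k ^ 2"

definition A_u :: "real \<Rightarrow> real \<Rightarrow> nat \<Rightarrow> real mat" where
  "A_u \<nu> \<mu> l = mat_diag (2 * l + 1) (\<lambda>r. growth_rate \<nu> \<mu> (wavenumber r))"

definition A_s :: "real \<Rightarrow> real \<Rightarrow> nat \<Rightarrow> nat \<Rightarrow> real mat" where
  "A_s \<nu> \<mu> l N = mat_diag (N - 2 * l) (\<lambda>r. growth_rate \<nu> \<mu> (wavenumber (2 * l + 1 + r)))"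

definition A_full :: "real \<Rightarrow> real \<Rightarrow> nat \<Rightarrow> nat \<Rightarrow> real mat" where
  "A_full \<nu> \<mu> l N =
     four_block_mat (A_u \<nu> \<mu> l) (0\<^sub>m (2 * l + 1) (N - 2 * l))
                    (0\<^sub>m (N - 2 * l) (2 * l + 1)) (A_s \<nu> \<mu> l N)"

(* The actuators are b 1, ..., b m, whereas matrix indices start at 0. *)
definition B_u :: "(nat \<Rightarrow> actuator) \<Rightarrow> nat \<Rightarrow> nat \<Rightarrow> real mat" where
  "B_u b l m = Matrix.mat (2 * l + 1) m (\<lambda>(r, j). mode_coeff (b (j + 1)) r)"

definition B_s :: "(nat \<Rightarrow> actuator) \<Rightarrow> nat \<Rightarrow> nat \<Rightarrow> nat \<Rightarrow> real mat" where
  "B_s b l N m = Matrix.mat (N - 2 * l) m (\<lambda>(r, j). mode_coeff (b (j + 1)) (2 * l + 1 + r))"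

definition BK :: "(nat \<Rightarrow> actuator) \<Rightarrow> nat \<Rightarrow> nat \<Rightarrow> nat \<Rightarrow> real mat \<Rightarrow> real mat" where
  "BK b l N m K =
     four_block_mat (B_u b l m * K) (0\<^sub>m (2 * l + 1) (N - 2 * l))
                    (B_s b l N m * K) (0\<^sub>m (N - 2 * l) (N - 2 * l))"

definition Delta :: "real \<Rightarrow> real \<Rightarrow> nat \<Rightarrow> real mat" where
  "Delta \<epsilon>1 \<epsilon>2 N =
     mat_diag (N + 1) (\<lambda>r. - \<epsilon>1 * real (wavenumber r) ^ 4 + \<epsilon>2 * real (wavenumber r) ^ 3)"

end

theory Submission
  imports Defs
begin
text \<open>
  Write \<open>M\<close> for the closed-loop matrix \<open>A + BK\<close>, \<open>D\<close> for the perturbation and \<open>\<gamma>\<close> for the square root in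
  the hypothesis. The argument is the classical one for the stability radius: along the segment
  \<open>M + t D\<close>, \<open>0 \<le> t \<le> 1\<close>, an eigenvalue can reach the closed right half-plane only by crossing the
  imaginary axis, and a crossing at \<open>\<i> \<omega>\<close> with eigenvector \<open>v\<close> would give
  \<open>(\<i> \<omega> - M) v = t D v\<close>, so that \<open>D\<close> would stretch \<open>v\<close> by at least the smallest singular value of
  \<open>\<i> \<omega> - M\<close>, hence by at least \<open>\<gamma>\<close>.

  Three ingredients enter. The first is that \<open>M\<close> itself is stable (\<open>closed_loop_stable\<close>): it is block
  lower triangular, one diagonal block has the prescribed eigenvalues, and the other is diagonal with
  entries that are negative because all its wavenumbers lie beyond the positive root of
  \<open>\<nu> k\<^sup>2 - \<mu> k - 1\<close>.

  The second is that the smallest singular value, which is defined through eigenvalues of \<open>X\<^sup>* X\<close>,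
  bounds \<open>\<parallel>X v\<parallel>\<close> from below (\<open>sigma_min_le_stretch\<close>). No diagonalisation is used for this: the least
  value of \<open>\<parallel>X v\<parallel>\<close> on the unit sphere exists by compactness, and a first-variation argument shows that
  it is a singular value.

  The third is that the spectrum cannot jump across the axis (\<open>no_unstable_eigenvalue_along_segment\<close>).
  Instead of continuity of roots this uses connectedness of \<open>[0, 1]\<close>. A monic polynomial of degree \<open>n\<close>
  without roots in the open right half-plane satisfies \<open>\<bar>p z\<bar> \<ge> (Re z)\<^sup>n\<close> there, and this survives limits;
  so the parameters with stable matrix form a closed set. The other parameters form a projection of a
  compact set of pairs \<open>(t, z)\<close>, hence also a closed set.

  The hypothesis is a non-strict inequality, while excluding a crossing needs a strict one. The
  strictness comes from the choice of norm: \<open>\<gamma>\<close> is the Frobenius norm of the diagonal matrix \<open>D\<close>, in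
  which every nonzero entry occurs twice, so its square is at least twice that of the operator norm.
  This gives \<open>\<parallel>D v\<parallel> < \<gamma> \<parallel>v\<parallel>\<close> unless \<open>\<gamma> = 0\<close>, and in that case \<open>D = 0\<close>.
\<close>

section \<open>The Hermitian norm and the adjoint\<close>

unbundle no vec_syntax

definition norm_sq :: "complex vec \<Rightarrow> real" where
  "norm_sq v = (\<Sum>i<dim_vec v. (cmod (v $ i))\<^sup>2)"

lemma norm_sq_nonneg: "norm_sq v \<ge> 0"
  unfolding norm_sq_def by (simp add: sum_nonneg)

lemma norm_sq_eq_0_iff:
  assumes "v \<in> carrier_vec n"
  shows "norm_sq v = 0 \<longleftrightarrow> v = 0\<^sub>v n"
  using assms unfolding norm_sq_def by (auto simp: sum_nonneg_eq_0_iff intro!: eq_vecI)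

lemma norm_sq_pos:
  assumes "v \<in> carrier_vec n" "v \<noteq> 0\<^sub>v n"
  shows "norm_sq v > 0"
  using norm_sq_nonneg[of v] norm_sq_eq_0_iff[OF assms(1)] assms(2) by linarith

lemma norm_sq_smult: "norm_sq (a \<cdot>\<^sub>v v) = (cmod a)\<^sup>2 * norm_sq v"
  unfolding norm_sq_def by (simp add: norm_mult power_mult_distrib sum_distrib_left)

lemma cscalar_prod_self: "v \<bullet>c v = complex_of_real (norm_sq v)"
  unfolding norm_sq_def scalar_prod_def
  by (simp add: complex_norm_square atLeast0LessThan del: of_real_power)

text \<open>
  The increment \<open>t\<close> is real, so this is a real quadratic in \<open>t\<close> whose linear coefficient is the first
  variation of the squared norm in direction \<open>w\<close>.
\<close>

lemma norm_sq_add_smult: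
  assumes "v \<in> carrier_vec n" "w \<in> carrier_vec n"
  shows "norm_sq (v + complex_of_real t \<cdot>\<^sub>v w)
           = norm_sq v + 2 * t * Re (v \<bullet>c w) + t\<^sup>2 * norm_sq w"
proof -
  have pt: "(cmod (x + complex_of_real t * y))\<^sup>2 = (cmod x)\<^sup>2 + 2 * t * Re (x * cnj y) + t\<^sup>2 * (cmod y)\<^sup>2" for x y
    unfolding cmod_power2 by (simp add: power2_eq_square algebra_simps)
  show ?thesis
    using assms unfolding norm_sq_def scalar_prod_def
    by (simp add: pt sum.distrib sum_distrib_left atLeast0LessThan mult.assoc distrib_left)
qed

lemma mat_adjoint_carrier: "A \<in> carrier_mat n m \<Longrightarrow> mat_adjoint A \<in> carrier_mat m n"
  unfolding mat_adjoint_def by (auto simp: mat_of_rows_def)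

lemma mat_adjoint_index:
  assumes "A \<in> carrier_mat n m" "i < m" "j < n"
  shows "mat_adjoint A $$ (i, j) = conjugate (A $$ (j, i))"
  using assms unfolding mat_adjoint_def by (auto simp: mat_of_rows_def)

lemma cscalar_prod_mult_mat_vec:
  fixes A :: "complex mat"
  assumes A: "A \<in> carrier_mat n m" and v: "v \<in> carrier_vec m" and w: "w \<in> carrier_vec n"
  shows "w \<bullet>c (A *\<^sub>v v) = (mat_adjoint A *\<^sub>v w) \<bullet>c v"
proof -
  have "w \<bullet>c (A *\<^sub>v v) = (\<Sum>i<n. \<Sum>j<m. w $ i * cnj (A $$ (i, j)) * cnj (v $ j))"
    using assms by (simp add: scalar_prod_def atLeast0LessThan sum_distrib_left mult.assoc)
  also have "\<dots> = (\<Sum>j<m. \<Sum>i<n. w $ i * cnj (A $$ (i, j)) * cnj (v $ j))"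
    by (rule sum.swap)
  also have "\<dots> = (mat_adjoint A *\<^sub>v w) \<bullet>c v"
    using assms mat_adjoint_carrier[OF A]
    by (auto simp: scalar_prod_def atLeast0LessThan sum_distrib_right sum_distrib_left
          mat_adjoint_index[OF A] mult_ac intro!: sum.cong)
  finally show ?thesis .
qed

section \<open>The smallest singular value as minimal stretch\<close>

text \<open>
  The first-order condition at a minimum: near \<open>t = 0\<close> the linear term dominates, so it must vanish. The
  test point \<open>- a / (\<bar>b\<bar> + 1)\<close> is close enough to \<open>0\<close> whatever the sign of \<open>b\<close>.
\<close>

lemma linear_coeff_zero_if_quadratic_nonneg:
  fixes a b :: real
  assumes "\<And>t. 0 \<le> 2 * t * a + t\<^sup>2 * b"
  shows "a = 0"
proof (rule ccontr)
  assume a: "a \<noteq> 0"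
  define c where "c = \<bar>b\<bar> + 1"
  have c: "c > 0" "b \<le> c" unfolding c_def by auto
  have "2 * (- a / c) * a + (- a / c)\<^sup>2 * b \<le> 2 * (- a / c) * a + (- a / c)\<^sup>2 * c"
    using c by (intro add_left_mono mult_left_mono) auto
  also have "\<dots> = - (a\<^sup>2 / c)"
    using c by (simp add: power2_eq_square field_simps)
  also have "\<dots> < 0" using a c by simp
  finally show False using assms[of "- a / c"] by linarith
qed

text \<open>
  Vectors whose dimension is a term rather than a type carry no topology. The unit sphere is
  therefore modelled by functions that vanish beyond the dimension, where compactness comes from
  Tychonoff's theorem for a product of closed discs and points.
\<close>

lemma compact_unit_sphere:
  "compact {f :: nat \<Rightarrow> complex. (\<forall>i\<ge>n. f i = 0) \<and> (\<Sum>i<n. (cmod (f i))\<^sup>2) = 1}" (is "compact ?S")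
proof -
  let ?B = "\<lambda>i. if i < n then cball (0::complex) 1 else {0}"
  have "compactin (product_topology (\<lambda>i. euclidean) UNIV) (PiE UNIV ?B)"
    by (subst compactin_PiE) auto
  then have B: "compact (PiE UNIV ?B)"
    by (simp add: euclidean_product_topology)
  have cl: "closed {f :: nat \<Rightarrow> complex. (\<Sum>i<n. (cmod (f i))\<^sup>2) = 1}"
    by (intro closed_Collect_eq continuous_intros continuous_on_product_coordinates)
  have "?S = PiE UNIV ?B \<inter> {f. (\<Sum>i<n. (cmod (f i))\<^sup>2) = 1}"
  proof -
    have "cmod (f i) \<le> 1" if "(\<Sum>i<n. (cmod (f i))\<^sup>2) = 1" "i < n" for f :: "nat \<Rightarrow> complex" and i
    proof -
      have "(cmod (f i))\<^sup>2 \<le> (\<Sum>i<n. (cmod (f i))\<^sup>2)"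
        using that(2) by (intro member_le_sum) auto
      then show ?thesis using that(1) by (simp add: abs_square_le_1)
    qed
    then show ?thesis
      by (auto simp: PiE_iff split: if_splits)
  qed
  then show ?thesis using compact_Int_closed[OF B cl] by simp
qed


text \<open>
  Let \<open>v\<close> minimise \<open>\<parallel>M v\<parallel>\<^sup>2\<close> on the unit sphere, with value \<open>c\<close>. By homogeneity the Hermitian form
  \<open>\<parallel>M w\<parallel>\<^sup>2 - c \<parallel>w\<parallel>\<^sup>2\<close> is nonnegative everywhere and vanishes at \<open>v\<close>, so its first variation at \<open>v\<close> is zero
  in every direction. The direction \<open>u = M\<^sup>* M v - c v\<close> has first variation \<open>2 \<parallel>u\<parallel>\<^sup>2\<close>; hence \<open>u = 0\<close> and \<open>c\<close>
  is an eigenvalue of \<open>M\<^sup>* M\<close>.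
\<close>

lemma minimal_stretch_is_singular_value:
  fixes M :: "complex mat"
  assumes M: "M \<in> carrier_mat n n" and n: "n > 0"
  obtains \<sigma> where "\<sigma> \<in> singular_values M"
    and "\<And>w. w \<in> carrier_vec n \<Longrightarrow> \<sigma>\<^sup>2 * norm_sq w \<le> norm_sq (M *\<^sub>v w)"
proof -
  define S where "S = {f :: nat \<Rightarrow> complex. (\<forall>i\<ge>n. f i = 0) \<and> (\<Sum>i<n. (cmod (f i))\<^sup>2) = 1}"
  define Q where "Q f = norm_sq (M *\<^sub>v vec n f)" for f
  have "compact S" unfolding S_def by (rule compact_unit_sphere)
  moreover have "(\<lambda>i. if i = 0 then 1 else 0) \<in> S"
    using n by (auto simp: S_def if_distrib[of cmod] if_distrib[of "\<lambda>x. x\<^sup>2"] cong: if_cong)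
  then have "S \<noteq> {}" by auto
  moreover have "continuous_on S Q"
  proof -
    have "Q = (\<lambda>f. \<Sum>i<n. (cmod (\<Sum>j<n. M $$ (i, j) * f j))\<^sup>2)"
      using M by (auto simp: Q_def norm_sq_def scalar_prod_def atLeast0LessThan fun_eq_iff)
    moreover have "continuous_on UNIV (\<lambda>f. \<Sum>i<n. (cmod (\<Sum>j<n. M $$ (i, j) * f j))\<^sup>2)"
      by (intro continuous_intros continuous_on_product_coordinates)
    ultimately show ?thesis using continuous_on_subset by blast
  qed
  ultimately obtain f where f: "f \<in> S" and fmin: "\<And>g. g \<in> S \<Longrightarrow> Q f \<le> Q g"
    using continuous_attains_inf[of S Q] by blast
  define v where "v = vec n f"
  have v: "v \<in> carrier_vec n" by (simp add: v_def)
  have v1: "norm_sq v = 1" using f by (simp add: v_def norm_sq_def S_def)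
  define c where "c = Q f"
  have c0: "c \<ge> 0" by (simp add: c_def Q_def norm_sq_nonneg)
  have min: "c * norm_sq w \<le> norm_sq (M *\<^sub>v w)" if w: "w \<in> carrier_vec n" for w
  proof (cases "w = 0\<^sub>v n")
    case True
    then show ?thesis using norm_sq_eq_0_iff[OF w] norm_sq_nonneg by simp
  next
    case False
    define r where "r = sqrt (norm_sq w)"
    have r: "r > 0" "r\<^sup>2 = norm_sq w"
      using norm_sq_pos[OF w False] by (simp_all add: r_def)
    define g where "g i = (if i < n then w $ i / complex_of_real r else 0)" for i
    have gw: "vec n g = complex_of_real (1 / r) \<cdot>\<^sub>v w"
      using w by (auto simp: g_def)
    have "(\<Sum>i<n. (cmod (g i))\<^sup>2) = norm_sq (vec n g)"
      by (simp add: norm_sq_def)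
    also have "\<dots> = 1"
      unfolding gw norm_sq_smult norm_of_real using r norm_sq_pos[OF w False]
      by (simp add: power_divide)
    finally have "g \<in> S" by (auto simp: S_def g_def)
    from fmin[OF this] have "c \<le> norm_sq (M *\<^sub>v (complex_of_real (1 / r) \<cdot>\<^sub>v w))"
      by (simp add: c_def Q_def[of g] gw)
    also have "M *\<^sub>v (complex_of_real (1 / r) \<cdot>\<^sub>v w) = complex_of_real (1 / r) \<cdot>\<^sub>v (M *\<^sub>v w)"
      using mult_mat_vec[OF M w] by simp
    finally have "c \<le> norm_sq (M *\<^sub>v w) / r\<^sup>2"
      by (simp add: norm_sq_smult norm_divide power_divide)
    then show ?thesis using r norm_sq_pos[OF w False] by (simp add: field_simps)
  qed
  have Mv: "M *\<^sub>v v \<in> carrier_vec n" using M v by simp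
  have MM: "mat_adjoint M \<in> carrier_mat n n" by (rule mat_adjoint_carrier[OF M])
  \<comment> \<open>half the gradient of the form at the minimiser, used as the direction of variation\<close>
  define u where "u = mat_adjoint M *\<^sub>v (M *\<^sub>v v) + complex_of_real (- c) \<cdot>\<^sub>v v"
  have MMv: "mat_adjoint M *\<^sub>v (M *\<^sub>v v) \<in> carrier_vec n" using MM Mv by simp
  have u: "u \<in> carrier_vec n" using MMv v by (simp add: u_def)
  have "norm_sq u = 0"
  proof (rule linear_coeff_zero_if_quadratic_nonneg)
    fix t
    have lin: "u \<bullet>c u = (M *\<^sub>v v) \<bullet>c (M *\<^sub>v u) - complex_of_real c * (v \<bullet>c u)"
    proof -
      have "u \<bullet>c u = (mat_adjoint M *\<^sub>v (M *\<^sub>v v)) \<bullet>c u + (complex_of_real (- c) \<cdot>\<^sub>v v) \<bullet>c u"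
        by (subst (1) u_def, rule add_scalar_prod_distrib[of _ n]) (use MMv v u in auto)
      then show ?thesis
        using cscalar_prod_mult_mat_vec[OF M u Mv] u v by simp
    qed
    have "norm_sq u = Re (u \<bullet>c u)" by (simp add: cscalar_prod_self)
    then have re: "norm_sq u = Re ((M *\<^sub>v v) \<bullet>c (M *\<^sub>v u)) - c * Re (v \<bullet>c u)"
      unfolding lin by simp
    have "M *\<^sub>v (v + complex_of_real t \<cdot>\<^sub>v u) = M *\<^sub>v v + complex_of_real t \<cdot>\<^sub>v (M *\<^sub>v u)"
      using mult_add_distrib_mat_vec[OF M v, of "complex_of_real t \<cdot>\<^sub>v u"] mult_mat_vec[OF M u] u
      by simp
    then have "norm_sq (M *\<^sub>v (v + complex_of_real t \<cdot>\<^sub>v u))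
        = c + 2 * t * Re ((M *\<^sub>v v) \<bullet>c (M *\<^sub>v u)) + t\<^sup>2 * norm_sq (M *\<^sub>v u)"
      using norm_sq_add_smult[OF Mv, of "M *\<^sub>v u" t] M u by (simp add: c_def Q_def v_def)
    moreover have "norm_sq (v + complex_of_real t \<cdot>\<^sub>v u)
        = 1 + 2 * t * Re (v \<bullet>c u) + t\<^sup>2 * norm_sq u"
      using norm_sq_add_smult[OF v u, of t] v1 by simp
    ultimately have "0 \<le> 2 * t * (Re ((M *\<^sub>v v) \<bullet>c (M *\<^sub>v u)) - c * Re (v \<bullet>c u))
        + t\<^sup>2 * (norm_sq (M *\<^sub>v u) - c * norm_sq u)"
      using min[of "v + complex_of_real t \<cdot>\<^sub>v u"] u v by (simp add: algebra_simps)
    then show "0 \<le> 2 * t * norm_sq u + t\<^sup>2 * (norm_sq (M *\<^sub>v u) - c * norm_sq u)"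
      by (simp only: re[symmetric])
  qed
  then have u0: "u = 0\<^sub>v n" using norm_sq_eq_0_iff[OF u] by simp
  have "mat_adjoint M * M *\<^sub>v v = complex_of_real c \<cdot>\<^sub>v v"
  proof (rule eq_vecI)
    fix i assume "i < dim_vec (complex_of_real c \<cdot>\<^sub>v v)"
    then have i: "i < n" using v by simp
    have "u $ i = 0" using u0 i by simp
    then have "(mat_adjoint M *\<^sub>v (M *\<^sub>v v)) $ i = complex_of_real c * v $ i"
      using i v MMv by (simp add: u_def)
    then show "(mat_adjoint M * M *\<^sub>v v) $ i = (complex_of_real c \<cdot>\<^sub>v v) $ i"
      using assoc_mult_mat_vec[OF MM M v] i v by simp
  qed (use MM v in simp)
  moreover have "v \<noteq> 0\<^sub>v n" using norm_sq_eq_0_iff[OF v] v1 by simp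
  ultimately have "eigenvalue (mat_adjoint M * M) (complex_of_real c)"
    unfolding eigenvalue_def eigenvector_def using v MM by auto
  then have "sqrt c \<in> singular_values M"
    using c0 by (simp add: singular_values_def flip: of_real_power)
  moreover have "(sqrt c)\<^sup>2 = c" using c0 by simp
  ultimately show thesis using that min by metis
qed

lemma finite_singular_values:
  assumes M: "M \<in> carrier_mat n n"
  shows "finite (singular_values M)"
proof (rule finite_imageD)
  have "mat_adjoint M * M \<in> carrier_mat n n" using M mat_adjoint_carrier[OF M] by simp
  from card_finite_spectrum(1)[OF this]
  show "finite ((\<lambda>\<sigma>. complex_of_real (\<sigma>\<^sup>2)) ` singular_values M)"
    by (rule finite_subset[rotated]) (auto simp: singular_values_def spectrum_def)
  show "inj_on (\<lambda>\<sigma>. complex_of_real (\<sigma>\<^sup>2)) (singular_values M)"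
    by (auto simp: inj_on_def singular_values_def simp flip: of_real_power)
qed

lemma sigma_min_nonneg:
  assumes "M \<in> carrier_mat n n" "n > 0"
  shows "sigma_min M \<ge> 0"
proof -
  have "singular_values M \<noteq> {}" using minimal_stretch_is_singular_value[OF assms] by blast
  then have "sigma_min M \<in> singular_values M"
    unfolding sigma_min_def using Min_in finite_singular_values[OF assms(1)] by blast
  then show ?thesis by (simp add: singular_values_def)
qed

lemma sigma_min_le_stretch:
  assumes "M \<in> carrier_mat n n" "n > 0" "w \<in> carrier_vec n"
  shows "(sigma_min M)\<^sup>2 * norm_sq w \<le> norm_sq (M *\<^sub>v w)"
proof -
  obtain \<sigma> where \<sigma>: "\<sigma> \<in> singular_values M" "\<sigma>\<^sup>2 * norm_sq w \<le> norm_sq (M *\<^sub>v w)"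
    using minimal_stretch_is_singular_value[OF assms(1,2)] assms(3) by metis
  have "sigma_min M \<le> \<sigma>"
    unfolding sigma_min_def using \<sigma>(1) finite_singular_values[OF assms(1)] by simp
  then have "(sigma_min M)\<^sup>2 \<le> \<sigma>\<^sup>2"
    using sigma_min_nonneg[OF assms(1,2)] by (intro power_mono)
  then show ?thesis
    using \<sigma>(2) norm_sq_nonneg[of w] by (meson mult_right_mono order_trans)
qed

section \<open>Eigenvalues along a segment of matrices\<close>

text \<open>
  The eigenvalue equation is read off in a coordinate where the eigenvector is largest in modulus. The
  sum over all entries is a crude bound, but it is continuous in the matrix, which suffices to
  confine the eigenvalues along a segment to one compact disc.
\<close>

lemma norm_eigenvalue_le_sum_norm_entries:
  fixes A :: "complex mat"
  assumes A: "A \<in> carrier_mat n n" and ev: "eigenvalue A z"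
  shows "cmod z \<le> (\<Sum>i<n. \<Sum>j<n. cmod (A $$ (i, j)))"
proof -
  obtain v where v: "v \<in> carrier_vec n" "v \<noteq> 0\<^sub>v n" "A *\<^sub>v v = z \<cdot>\<^sub>v v"
    using ev A unfolding eigenvalue_def eigenvector_def by auto
  obtain k where k: "k < n" "v $ k \<noteq> 0" using v(1,2) by (metis carrier_vecD eq_vecI index_zero_vec)
  have "Max ((\<lambda>i. cmod (v $ i)) ` {..<n}) \<in> (\<lambda>i. cmod (v $ i)) ` {..<n}"
    using k by (intro Max_in) auto
  then obtain i where i: "i < n" and "Max ((\<lambda>i. cmod (v $ i)) ` {..<n}) = cmod (v $ i)" by auto
  then have imax: "cmod (v $ j) \<le> cmod (v $ i)" if "j < n" for j
    using that by (metis Max_ge finite_imageI finite_lessThan imageI lessThan_iff)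
  have pos: "cmod (v $ i) > 0" using imax[OF k(1)] k(2) by (meson less_le_trans zero_less_norm_iff)
  have "z * v $ i = (\<Sum>j<n. A $$ (i, j) * v $ j)"
    using arg_cong[OF v(3), of "\<lambda>w. w $ i"] A v(1) i
    by (simp add: scalar_prod_def atLeast0LessThan)
  then have "cmod z * cmod (v $ i) \<le> (\<Sum>j<n. cmod (A $$ (i, j)) * cmod (v $ j))"
    by (metis (no_types, lifting) norm_mult norm_sum sum.cong)
  also have "\<dots> \<le> (\<Sum>j<n. cmod (A $$ (i, j)) * cmod (v $ i))"
    by (intro sum_mono mult_left_mono imax) auto
  also have "\<dots> = (\<Sum>j<n. cmod (A $$ (i, j))) * cmod (v $ i)"
    by (simp add: sum_distrib_right)
  finally have "cmod z \<le> (\<Sum>j<n. cmod (A $$ (i, j)))" using pos by simp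
  also have "\<dots> \<le> (\<Sum>i<n. \<Sum>j<n. cmod (A $$ (i, j)))"
    using i by (intro member_le_sum[of i _ "\<lambda>i. \<Sum>j<n. cmod (A $$ (i, j))"]) (auto intro: sum_nonneg)
  finally show ?thesis .
qed

text \<open>
  Each linear factor \<open>z - a\<close> of the characteristic polynomial has modulus at least
  \<open>Re z - Re a \<ge> Re z\<close>. This is the quantitative form of having no unstable eigenvalue that passes to
  limits of matrices.
\<close>

lemma norm_char_poly_ge_if_no_unstable_eigenvalue:
  fixes A :: "complex mat"
  assumes A: "A \<in> carrier_mat n n" and ev: "\<And>a. eigenvalue A a \<Longrightarrow> Re a \<le> 0" and z: "Re z \<ge> 0"
  shows "Re z ^ n \<le> cmod (poly (char_poly A) z)"
proof -
  obtain as where as: "char_poly A = (\<Prod>a\<leftarrow>as. [:- a, 1:])" and len: "length as = n"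
    using char_poly_factorized[OF A] by blast
  have "Re a \<le> 0" if "a \<in> set as" for a
  proof -
    have "poly (char_poly A) a = 0"
      unfolding as poly_prod_list using that by (auto simp: prod_list_zero_iff)
    then show ?thesis using ev eigenvalue_root_char_poly[OF A] by blast
  qed
  then have "Re z ^ length as \<le> cmod (poly (\<Prod>a\<leftarrow>as. [:- a, 1:]) z)"
  proof (induction as)
    case (Cons a as)
    have "Re z \<le> cmod (z - a)"
      using Cons.prems[of a] abs_Re_le_cmod[of "z - a"] by simp
    then have "Re z * Re z ^ length as \<le> cmod (z - a) * cmod (poly (\<Prod>a\<leftarrow>as. [:- a, 1:]) z)"
      using Cons z by (intro mult_mono) auto
    moreover have "poly (\<Prod>a\<leftarrow>a # as. [:- a, 1:]) z = (z - a) * poly (\<Prod>a\<leftarrow>as. [:- a, 1:]) z"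
      by (simp add: algebra_simps)
    ultimately show ?case by (simp only: norm_mult list.size power_Suc add_Suc_right add_0_right)
  qed simp
  then show ?thesis using as len by simp
qed

lemma continuous_on_char_poly:
  fixes F :: "'a::topological_space \<Rightarrow> complex mat"
  assumes F: "\<And>x. F x \<in> carrier_mat n n"
    and cont: "\<And>i j. i < n \<Longrightarrow> j < n \<Longrightarrow> continuous_on S (\<lambda>x. F x $$ (i, j))"
    and g: "continuous_on S g"
  shows "continuous_on S (\<lambda>x. poly (char_poly (F x)) (g x))"
proof -
  have C: "- char_matrix (F x) (g x) \<in> carrier_mat n n" for x
    using F[of x] by (simp add: char_matrix_def)
  have "continuous_on S (\<lambda>x. (- char_matrix (F x) (g x)) $$ (i, p i))"
    if "p permutes {0..<n}" "i \<in> {0..<n}" for p i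
  proof -
    have ij: "i < n" "p i < n" using that permutes_in_image by fastforce+
    have eq: "(- char_matrix (F x) (g x)) $$ (i, p i) = (if i = p i then g x else 0) - F x $$ (i, p i)" for x
      using ij carrier_matD[OF F] by (auto simp: char_matrix_def)
    have "continuous_on S (\<lambda>x. (if i = p i then g x else 0) - F x $$ (i, p i))"
      using cont[OF ij] g by (cases "i = p i") (auto intro!: continuous_intros)
    then show ?thesis unfolding eq .
  qed
  then show ?thesis
    unfolding char_poly_matrix[OF F] det_def'[OF C] by (intro continuous_intros) auto
qed

text \<open>
  If no eigenvalue lies on the imaginary axis for any \<open>t\<close>, the parameters split into the set \<open>G\<close>, where
  all eigenvalues have negative real part, and the projection of the set \<open>B\<close> of pairs \<open>(t, z)\<close> with an
  eigenvalue \<open>z\<close> of nonnegative real part. Both are closed and \<open>0\<close> belongs to the first, so by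
  connectedness the second is empty.
\<close>

lemma no_unstable_eigenvalue_along_segment:
  fixes A D :: "complex mat"
  assumes A: "A \<in> carrier_mat n n" and D: "D \<in> carrier_mat n n"
    and stable: "\<And>z. eigenvalue A z \<Longrightarrow> Re z < 0"
    and axis: "\<And>t \<omega>. 0 \<le> t \<Longrightarrow> t \<le> 1 \<Longrightarrow>
      \<not> eigenvalue (A + complex_of_real t \<cdot>\<^sub>m D) (\<i> * complex_of_real \<omega>)"
    and z: "eigenvalue (A + D) z"
  shows "Re z < 0"
proof -
  define F where "F t = A + complex_of_real t \<cdot>\<^sub>m D" for t
  define p where "p t z = poly (char_poly (F t)) z" for t z
  have F: "F t \<in> carrier_mat n n" for t using A D by (simp add: F_def)
  have ev: "eigenvalue (F t) z \<longleftrightarrow> p t z = 0" for t z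
    unfolding p_def by (rule eigenvalue_root_char_poly[OF F])
  have entry: "F t $$ (i, j) = A $$ (i, j) + complex_of_real t * D $$ (i, j)"
    if "i < n" "j < n" for t i j using that A D by (simp add: F_def)
  have contp: "continuous_on S (\<lambda>x. p (f x) (g x))"
    if "continuous_on S f" "continuous_on S g" for f :: "'c::topological_space \<Rightarrow> real" and g S
    unfolding p_def using that
    by (intro continuous_on_char_poly[of "\<lambda>x. F (f x)", OF F])
       (auto simp: entry intro!: continuous_intros)
  define G where "G = {0..1} \<inter> (\<Inter>z \<in> {z. Re z > 0}. {t. Re z ^ n \<le> cmod (p t z)})"
  \<comment> \<open>\<open>G\<close> is defined by inequalities between continuous functions rather than by eigenvalues, so
    that it is visibly closed; \<open>R\<close> bounds all eigenvalues for \<open>t\<close> in the unit interval\<close>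
  define R where "R = (\<Sum>i<n. \<Sum>j<n. cmod (A $$ (i, j)) + cmod (D $$ (i, j)))"
  define B where "B = {0..1} \<times> (cball 0 R \<inter> {z. Re z \<ge> 0}) \<inter> {x. p (fst x) (snd x) = 0}"
  have good: "t \<in> G \<longleftrightarrow> (\<forall>z. eigenvalue (F t) z \<longrightarrow> Re z < 0)" if t: "t \<in> {0..1}" for t
  proof
    assume G: "t \<in> G"
    show "\<forall>z. eigenvalue (F t) z \<longrightarrow> Re z < 0"
    proof (intro allI impI)
      fix z assume z: "eigenvalue (F t) z"
      have "\<not> Re z > 0"
      proof
        assume "Re z > 0"
        moreover from this have "Re z ^ n \<le> cmod (p t z)" using G by (auto simp: G_def)
        ultimately show False using z ev by (metis norm_zero not_le zero_less_power)
      qed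
      moreover have "Re z \<noteq> 0"
      proof
        assume "Re z = 0"
        then have "z = \<i> * complex_of_real (Im z)" by (simp add: complex_eq_iff)
        then show False using axis[of t "Im z"] t z by (simp add: F_def)
      qed
      ultimately show "Re z < 0" by simp
    qed
  next
    assume "\<forall>z. eigenvalue (F t) z \<longrightarrow> Re z < 0"
    then have "Re a \<le> 0" if "eigenvalue (F t) a" for a using that by force
    then show "t \<in> G" unfolding G_def p_def using t
      by (auto intro!: norm_char_poly_ge_if_no_unstable_eigenvalue[OF F])
  qed
  have bad: "t \<in> fst ` B \<longleftrightarrow> \<not> (\<forall>z. eigenvalue (F t) z \<longrightarrow> Re z < 0)" if t: "t \<in> {0..1}" for t
  proof
    assume "t \<in> fst ` B"
    then obtain z where "Re z \<ge> 0" "p t z = 0" by (auto simp: B_def)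
    then show "\<not> (\<forall>z. eigenvalue (F t) z \<longrightarrow> Re z < 0)" using ev by force
  next
    assume "\<not> (\<forall>z. eigenvalue (F t) z \<longrightarrow> Re z < 0)"
    then obtain z where z: "eigenvalue (F t) z" "Re z \<ge> 0" by force
    have "cmod z \<le> (\<Sum>i<n. \<Sum>j<n. cmod (F t $$ (i, j)))"
      by (rule norm_eigenvalue_le_sum_norm_entries[OF F z(1)])
    also have "\<dots> \<le> R" unfolding R_def
    proof (intro sum_mono)
      fix i j assume "i \<in> {..<n}" "j \<in> {..<n}"
      then have "cmod (F t $$ (i, j)) \<le> cmod (A $$ (i, j)) + \<bar>t\<bar> * cmod (D $$ (i, j))"
        using norm_triangle_ineq[of "A $$ (i, j)" "complex_of_real t * D $$ (i, j)"]
        by (simp add: entry norm_mult)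
      also have "\<dots> \<le> cmod (A $$ (i, j)) + cmod (D $$ (i, j))"
        using t by (simp add: mult_left_le_one_le)
      finally show "cmod (F t $$ (i, j)) \<le> cmod (A $$ (i, j)) + cmod (D $$ (i, j))" .
    qed
    finally have "(t, z) \<in> B" using z t ev by (auto simp: B_def)
    then show "t \<in> fst ` B" by force
  qed
  have "closed G" unfolding G_def
    by (intro closed_Int closed_INT ballI closed_Collect_le continuous_intros contp)
  moreover have "closed (fst ` B)"
  proof -
    have "compact B" unfolding B_def
      by (intro compact_Int_closed compact_Times closed_Collect_eq closed_Collect_le
            continuous_intros contp) auto
    then show ?thesis by (intro compact_imp_closed compact_continuous_image continuous_intros)
  qed
  moreover have "G \<inter> fst ` B \<inter> {0..1} = {}" "{0..1} \<subseteq> G \<union> fst ` B" using good bad by blast+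
  ultimately have "G \<inter> {0..1} = {} \<or> fst ` B \<inter> {0..1} = {}"
    using connected_closedD[of "{0..1::real}" G "fst ` B"] by simp
  moreover have "F 0 = A" using A D by (auto simp: F_def)
  then have "0 \<in> G" using good[of 0] stable by simp
  ultimately have "1 \<notin> fst ` B" by fastforce
  moreover have "F 1 = A + D" using D by (auto simp: F_def)
  ultimately show ?thesis using bad[of 1] z by simp
qed

text \<open>
  The stability radius bound. An eigenvector \<open>v\<close> of \<open>A + t D\<close> for \<open>\<i> \<omega>\<close> satisfies
  \<open>(\<i> \<omega> - A) v = t D v\<close>, so the smallest singular value of \<open>\<i> \<omega> - A\<close> is at most \<open>\<parallel>D v\<parallel> / \<parallel>v\<parallel> < \<gamma>\<close>.
\<close>

lemma no_unstable_eigenvalue_if_perturbation_below_sigma_min: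
  fixes A D :: "complex mat"
  assumes A: "A \<in> carrier_mat n n" and D: "D \<in> carrier_mat n n"
    and stable: "\<And>z. eigenvalue A z \<Longrightarrow> Re z < 0"
    and \<gamma>: "0 \<le> \<gamma>" "\<And>\<omega>. \<gamma> \<le> sigma_min ((\<i> * complex_of_real \<omega>) \<cdot>\<^sub>m 1\<^sub>m n - A)"
    and small: "\<And>v. v \<in> carrier_vec n \<Longrightarrow> v \<noteq> 0\<^sub>v n \<Longrightarrow> norm_sq (D *\<^sub>v v) < \<gamma>\<^sup>2 * norm_sq v"
    and z: "eigenvalue (A + D) z"
  shows "Re z < 0"
proof (rule no_unstable_eigenvalue_along_segment[OF A D stable _ z])
  fix t \<omega> :: real
  assume t: "0 \<le> t" "t \<le> 1"
  let ?s = "\<i> * complex_of_real \<omega>"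
  let ?X = "?s \<cdot>\<^sub>m 1\<^sub>m n - A"
  show "\<not> eigenvalue (A + complex_of_real t \<cdot>\<^sub>m D) ?s"
  proof
    assume "eigenvalue (A + complex_of_real t \<cdot>\<^sub>m D) ?s"
    then obtain v where v: "v \<in> carrier_vec n" "v \<noteq> 0\<^sub>v n"
      and eq: "(A + complex_of_real t \<cdot>\<^sub>m D) *\<^sub>v v = ?s \<cdot>\<^sub>v v"
      using A D unfolding eigenvalue_def eigenvector_def by auto
    have n: "n > 0" using v by (cases n) auto
    have X: "?X \<in> carrier_mat n n" by (rule minus_carrier_mat[OF A])
    have "?X *\<^sub>v v = (?s \<cdot>\<^sub>m 1\<^sub>m n) *\<^sub>v v - A *\<^sub>v v"
      using minus_mult_distrib_mat_vec[of "?s \<cdot>\<^sub>m 1\<^sub>m n" n n A v] A v by simp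
    also have "(?s \<cdot>\<^sub>m 1\<^sub>m n) *\<^sub>v v = ?s \<cdot>\<^sub>v v"
      using v by auto
    also have "\<dots> = A *\<^sub>v v + (complex_of_real t \<cdot>\<^sub>m D) *\<^sub>v v"
      using eq add_mult_distrib_mat_vec[of A n n "complex_of_real t \<cdot>\<^sub>m D" v] A D v
      by simp
    also have "(complex_of_real t \<cdot>\<^sub>m D) *\<^sub>v v = complex_of_real t \<cdot>\<^sub>v (D *\<^sub>v v)"
      using D v by (intro eq_vecI) auto
    finally have Xv: "?X *\<^sub>v v = complex_of_real t \<cdot>\<^sub>v (D *\<^sub>v v)"
      using A D v by auto
    have "\<gamma>\<^sup>2 * norm_sq v \<le> (sigma_min ?X)\<^sup>2 * norm_sq v"
      using \<gamma> norm_sq_nonneg by (intro mult_right_mono power_mono) auto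
    also have "\<dots> \<le> norm_sq (?X *\<^sub>v v)" by (rule sigma_min_le_stretch[OF X n v(1)])
    also have "\<dots> = t\<^sup>2 * norm_sq (D *\<^sub>v v)" by (simp add: Xv norm_sq_smult)
    also have "\<dots> \<le> norm_sq (D *\<^sub>v v)"
      using t norm_sq_nonneg by (intro mult_left_le_one_le) (auto simp: power_le_one)
    also have "\<dots> < \<gamma>\<^sup>2 * norm_sq v" by (rule small[OF v])
    finally show False by simp
  qed
qed


section \<open>Stability of the nominal closed loop\<close>

lemma mat_diag_mult_vec_index:
  fixes f :: "nat \<Rightarrow> 'a::semiring_0"
  assumes "v \<in> carrier_vec n" "i < n"
  shows "(mat_diag n f *\<^sub>v v) $ i = f i * v $ i"
proof -
  have "(mat_diag n f *\<^sub>v v) $ i = (\<Sum>j<n. (if i = j then f j else 0) * v $ j)"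
    using assms by (simp add: mat_diag_def scalar_prod_def atLeast0LessThan)
  also have "\<dots> = (\<Sum>j<n. if j = i then f j * v $ j else 0)"
    by (rule sum.cong) auto
  finally show ?thesis using assms(2) by simp
qed

lemma eigenvalue_mat_diag:
  fixes f :: "nat \<Rightarrow> 'a::field"
  assumes "eigenvalue (mat_diag n f) z"
  obtains r where "r < n" "z = f r"
proof -
  obtain v where v: "v \<in> carrier_vec n" "v \<noteq> 0\<^sub>v n" "mat_diag n f *\<^sub>v v = z \<cdot>\<^sub>v v"
    using assms unfolding eigenvalue_def eigenvector_def by (auto simp: mat_diag_def)
  then obtain i where i: "i < n" "v $ i \<noteq> 0" by (metis carrier_vecD eq_vecI index_zero_vec)
  have "f i * v $ i = z * v $ i"
    using mat_diag_mult_vec_index[OF v(1) i(1), of f] v(1,3) i(1) by auto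
  then have "z = f i" using i(2) by auto
  then show thesis by (rule that[OF i(1)])
qed

lemma eigenvalue_block_lower_triangular:
  fixes A1 :: "'a::field mat"
  assumes A1: "A1 \<in> carrier_mat n n" and A3: "A3 \<in> carrier_mat m n" and A4: "A4 \<in> carrier_mat m m"
    and ev: "eigenvalue (four_block_mat A1 (0\<^sub>m n m) A3 A4) z"
  shows "eigenvalue A1 z \<or> eigenvalue A4 z"
proof -
  let ?M = "four_block_mat A1 (0\<^sub>m n m) A3 A4"
  have M: "?M \<in> carrier_mat (n + m) (n + m)" using A1 A4 by (rule four_block_carrier_mat)
  have "char_matrix ?M z = four_block_mat (char_matrix A1 z) (0\<^sub>m n m) A3 (char_matrix A4 z)"
    using A1 A3 A4 by (intro eq_matI) (auto simp: char_matrix_def)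
  then have "det (char_matrix ?M z) = det (char_matrix A1 z) * det (char_matrix A4 z)"
    using A1 A3 A4 by (simp add: det_four_block_mat_upper_right_zero[of _ n _ m])
  then show ?thesis
    using ev unfolding eigenvalue_det[OF M] eigenvalue_det[OF A1] eigenvalue_det[OF A4] by auto
qed

text \<open>
  The growth rate factors as \<open>- k\<^sup>2 (\<nu> k\<^sup>2 - \<mu> k - 1)\<close>, and the bound on \<open>k\<close> is the larger root of the
  quadratic factor; completing the square turns it into the sign of that factor.
\<close>

lemma growth_rate_neg:
  assumes \<nu>: "\<nu> > 0" and k: "real k > (\<mu> + sqrt (\<mu>\<^sup>2 + 4 * \<nu>)) / (2 * \<nu>)"
  shows "growth_rate \<nu> \<mu> k < 0"
proof -
  define s where "s = sqrt (\<mu>\<^sup>2 + 4 * \<nu>)"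
  have s2: "s\<^sup>2 = \<mu>\<^sup>2 + 4 * \<nu>" and s: "s \<ge> \<bar>\<mu>\<bar>"
    using \<nu> by (auto simp: s_def intro!: real_le_rsqrt)
  have 1: "2 * \<nu> * real k - \<mu> > s"
    using k \<nu> by (simp add: s_def field_simps)
  then have "(2 * \<nu> * real k - \<mu>)\<^sup>2 > s\<^sup>2"
    using s by (intro power_strict_mono) auto
  then have "4 * \<nu> * (\<nu> * (real k)\<^sup>2 - \<mu> * real k - 1) > 0"
    unfolding s2 by (simp add: power2_eq_square algebra_simps)
  then have q: "\<nu> * (real k)\<^sup>2 - \<mu> * real k - 1 > 0"
    using \<nu> by (simp add: zero_less_mult_iff)
  have "k > 0" using 1 s by (cases k) auto
  then have "(real k)\<^sup>2 * (\<nu> * (real k)\<^sup>2 - \<mu> * real k - 1) > 0"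
    using q by simp
  moreover have "growth_rate \<nu> \<mu> k = - ((real k)\<^sup>2 * (\<nu> * (real k)\<^sup>2 - \<mu> * real k - 1))"
    by (simp add: growth_rate_def algebra_simps power2_eq_square power3_eq_cube power4_eq_xxxx)
  ultimately show ?thesis by simp
qed

lemma cmat_mat_diag: "cmat (mat_diag n f) = mat_diag n (\<lambda>r. complex_of_real (f r))"
  by (auto simp: mat_diag_def)

lemma has_eigenvaluesD:
  assumes "M \<in> carrier_mat n n" "has_eigenvalues M n k" "eigenvalue M z"
  obtains i where "i \<in> {1..n}" "z = k i"
proof -
  have "poly (char_poly M) z = 0" using assms eigenvalue_root_char_poly by blast
  then show thesis using assms(2) that by (auto simp: has_eigenvalues_def poly_prod)
qed

lemma A_full_plus_BK:
  assumes "m = 2 * l + 1" "K \<in> carrier_mat m m"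
  shows "A_full \<nu> \<mu> l N + BK b l N m K =
    four_block_mat (A_u \<nu> \<mu> l + B_u b l m * K) (0\<^sub>m (2 * l + 1) (N - 2 * l))
                   (B_s b l N m * K) (A_s \<nu> \<mu> l N)"
  unfolding A_full_def BK_def using assms
  by (subst add_four_block_mat[of _ "2 * l + 1" "2 * l + 1" _ "N - 2 * l" _ "N - 2 * l"])
     (auto simp: A_u_def A_s_def B_u_def B_s_def mat_diag_def)

text \<open>
  The feedback reads only the first \<open>2 l + 1\<close> modes, so it leaves the remaining diagonal block
  untouched and couples the two blocks in one direction only. The eigenvalues are therefore the
  prescribed ones together with the open-loop growth rates of wavenumbers at least \<open>l + 1\<close>.
\<close>

lemma closed_loop_stable:
  assumes \<nu>: "\<nu> > 0" and l: "real l + 1 > (\<mu> + sqrt (\<mu>\<^sup>2 + 4 * \<nu>)) / (2 * \<nu>)"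
    and m: "m = 2 * l + 1" and K: "K \<in> carrier_mat m m"
    and eigs: "has_eigenvalues (cmat (A_u \<nu> \<mu> l + B_u b l m * K)) m eigs"
    and neg: "\<And>i. i \<in> {1..m} \<Longrightarrow> Re (eigs i) < 0"
    and z: "eigenvalue (cmat (A_full \<nu> \<mu> l N + BK b l N m K)) z"
  shows "Re z < 0"
proof -
  let ?U = "A_u \<nu> \<mu> l + B_u b l m * K" and ?L = "B_s b l N m * K" and ?S = "A_s \<nu> \<mu> l N"
  have U: "?U \<in> carrier_mat m m" and L: "?L \<in> carrier_mat (N - 2 * l) m"
    and S: "?S \<in> carrier_mat (N - 2 * l) (N - 2 * l)"
    using m K by (auto simp: A_u_def A_s_def B_u_def B_s_def mat_diag_def)
  have zero: "cmat (0\<^sub>m i j) = 0\<^sub>m i j" for i j by (intro eq_matI) auto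
  have "cmat (A_full \<nu> \<mu> l N + BK b l N m K)
      = four_block_mat (cmat ?U) (0\<^sub>m m (N - 2 * l)) (cmat ?L) (cmat ?S)"
    unfolding A_full_plus_BK[OF m K] using U L S m
    by (subst map_four_block_mat[of _ m m _ "N - 2 * l" _ "N - 2 * l"])
       (auto simp: zero)
  then have "eigenvalue (cmat ?U) z \<or> eigenvalue (cmat ?S) z"
    using z U L S by (intro eigenvalue_block_lower_triangular[of _ m "cmat ?L" "N - 2 * l"]) auto
  then show ?thesis
  proof
    assume "eigenvalue (cmat ?U) z"
    then show ?thesis using has_eigenvaluesD[OF _ eigs] U neg by auto
  next
    assume "eigenvalue (cmat ?S) z"
    then obtain r where z: "z = complex_of_real (growth_rate \<nu> \<mu> (wavenumber (2 * l + 1 + r)))"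
      unfolding A_s_def cmat_mat_diag by (rule eigenvalue_mat_diag)
    have "l + 1 \<le> wavenumber (2 * l + 1 + r)" by (simp add: wavenumber_def)
    then have "real l + 1 \<le> real (wavenumber (2 * l + 1 + r))" by linarith
    then show ?thesis using growth_rate_neg[OF \<nu>] l unfolding z by simp
  qed
qed

section \<open>The perturbed closed loop\<close>

text \<open>
  Only the constant mode has wavenumber \<open>0\<close>; a sine and a cosine share each other one. A single
  entry is thus bounded by the sum over wavenumbers, which is half of the sum over modes. Applied to
  squared errors, this is the factor \<open>2\<close> between the squares of the Frobenius and operator norms.
\<close>

lemma mode_error_le_half_sum:
  fixes g :: "nat \<Rightarrow> real"
  assumes "g 0 = 0" "\<And>k. g k \<ge> 0" "r < 2 * h + 1"
  shows "g (wavenumber r) \<le> (\<Sum>k=1..h. g k)"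
proof (cases "wavenumber r = 0")
  case True
  then show ?thesis using assms by (simp add: sum_nonneg)
next
  case False
  then have "wavenumber r \<in> {1..h}" using assms(3) by (auto simp: wavenumber_def)
  then show ?thesis using assms(2) by (intro member_le_sum) auto
qed

theorem proposition4:
  fixes \<nu> \<mu> \<epsilon>1 \<epsilon>2 :: real
    and l m N :: nat
    and b :: "nat \<Rightarrow> actuator"
    and K :: "real mat"
    and eigs :: "nat \<Rightarrow> complex"
  assumes "\<nu> > 0" and "\<mu> \<ge> 0"
    and "real l + 1 > (\<mu> + sqrt (\<mu>\<^sup>2 + 4 * \<nu>)) / (2 * \<nu>)"
    and "(\<mu> + sqrt (\<mu>\<^sup>2 + 4 * \<nu>)) / (2 * \<nu>) > real l"
    and "m = 2 * l + 1"
    and "even N" and "N div 2 > l"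
    and "\<And>i. i \<in> {1..m} \<Longrightarrow> admissible_actuator (b i)"
    and "K \<in> carrier_mat m m"
    and "has_eigenvalues (cmat (A_u \<nu> \<mu> l + B_u b l m * K)) m eigs"
    and "\<And>i. i \<in> {1..m} \<Longrightarrow> Re (eigs i) < 0"
    and "sqrt (2 * (\<Sum>k=1..N div 2. real k ^ 6 *
             (\<epsilon>1\<^sup>2 * real k ^ 2 - 2 * \<epsilon>1 * \<epsilon>2 * real k + \<epsilon>2\<^sup>2)))
         \<le> (INF \<omega>::real. sigma_min ((\<i> * complex_of_real \<omega>) \<cdot>\<^sub>m 1\<^sub>m (N + 1)
                                  - cmat (A_full \<nu> \<mu> l N + BK b l N m K)))"
  shows "stable_mat (A_full \<nu> \<mu> l N + BK b l N m K + Delta \<epsilon>1 \<epsilon>2 N)"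
proof -
  define M where "M = A_full \<nu> \<mu> l N + BK b l N m K"
  define \<delta> where "\<delta> k = - \<epsilon>1 * real k ^ 4 + \<epsilon>2 * real k ^ 3" for k
  define h where "h = N div 2"
  define F where "F = (\<Sum>k=1..h. (\<delta> k)\<^sup>2)"
  define \<gamma> where "\<gamma> = sqrt (2 * F)"
  let ?D = "Delta \<epsilon>1 \<epsilon>2 N"
  have N: "N = 2 * h" using \<open>even N\<close> by (simp add: h_def)
  have blocks: "2 * l + 1 + (N - 2 * l) = N + 1" using \<open>N div 2 > l\<close> by linarith
  have M: "M \<in> carrier_mat (N + 1) (N + 1)"
  proof -
    have "A_u \<nu> \<mu> l + B_u b l m * K \<in> carrier_mat (2 * l + 1) (2 * l + 1)"
      using assms(5,9) by (auto simp: A_u_def B_u_def mat_diag_def)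
    moreover have "A_s \<nu> \<mu> l N \<in> carrier_mat (N - 2 * l) (N - 2 * l)" by (simp add: A_s_def)
    ultimately have "M \<in> carrier_mat (2 * l + 1 + (N - 2 * l)) (2 * l + 1 + (N - 2 * l))"
      unfolding M_def A_full_plus_BK[OF assms(5,9)] by (rule four_block_carrier_mat)
    then show ?thesis unfolding blocks .
  qed
  have D: "?D \<in> carrier_mat (N + 1) (N + 1)" by (simp add: Delta_def)
  have Mstable: "Re z < 0" if "eigenvalue (cmat M) z" for z
    using closed_loop_stable[OF assms(1,3,5,9,10,11)] that unfolding M_def by blast
  have F0: "F \<ge> 0" by (simp add: F_def sum_nonneg)
  have \<delta>F: "(\<delta> (wavenumber r))\<^sup>2 \<le> F" if "r < N + 1" for r
    unfolding F_def using that N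
    by (intro mode_error_le_half_sum[of "\<lambda>k. (\<delta> k)\<^sup>2"]) (auto simp: \<delta>_def)
  have "(\<delta> k)\<^sup>2 = real k ^ 6 * (\<epsilon>1\<^sup>2 * real k ^ 2 - 2 * \<epsilon>1 * \<epsilon>2 * real k + \<epsilon>2\<^sup>2)" for k
    proof -
    have "\<delta> k = real k ^ 3 * (\<epsilon>2 - \<epsilon>1 * real k)"
      by (simp add: \<delta>_def algebra_simps power3_eq_cube power4_eq_xxxx)
    then show ?thesis
      by (simp add: power_mult_distrib flip: power_mult) (simp add: power2_diff power_mult_distrib)
  qed
  then have \<gamma>_le_INF: "\<gamma> \<le> (INF \<omega>::real. sigma_min ((\<i> * complex_of_real \<omega>) \<cdot>\<^sub>m 1\<^sub>m (N + 1) - cmat M))"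
    using assms(12) by (simp add: \<gamma>_def F_def h_def M_def)
  have \<gamma>_le: "\<gamma> \<le> sigma_min ((\<i> * complex_of_real \<omega>) \<cdot>\<^sub>m 1\<^sub>m (N + 1) - cmat M)" for \<omega>
  proof -
    have "sigma_min ((\<i> * complex_of_real \<omega>) \<cdot>\<^sub>m 1\<^sub>m (N + 1) - cmat M) \<ge> 0" for \<omega>
      using M by (intro sigma_min_nonneg[of _ "N + 1"] minus_carrier_mat) auto
    then show ?thesis
      by (intro order_trans[OF \<gamma>_le_INF] cINF_lower bdd_belowI2[of _ 0]) auto
  qed
  have "Re z < 0" if z: "eigenvalue (cmat (M + ?D)) z" for z
  proof (cases "F = 0")
    case True
    have "\<delta> (wavenumber r) = 0" if "r < N + 1" for r using \<delta>F[OF that] True by simp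
    then have "?D = 0\<^sub>m (N + 1) (N + 1)"
      by (intro eq_matI) (auto simp: Delta_def mat_diag_def \<delta>_def)
    then show ?thesis using z M Mstable by simp
  next
    case False
    \<comment> \<open>strict, because \<open>\<gamma>\<^sup>2 = 2 F\<close> whereas every squared entry of \<open>D\<close> is at most \<open>F > 0\<close>\<close>
    have small: "norm_sq (cmat ?D *\<^sub>v v) < \<gamma>\<^sup>2 * norm_sq v"
      if v: "v \<in> carrier_vec (N + 1)" "v \<noteq> 0\<^sub>v (N + 1)" for v
    proof -
      have "norm_sq (cmat ?D *\<^sub>v v) = (\<Sum>r<N + 1. (\<delta> (wavenumber r))\<^sup>2 * (cmod (v $ r))\<^sup>2)"
      proof -
        have "(cmat ?D *\<^sub>v v) $ r = complex_of_real (\<delta> (wavenumber r)) * v $ r" if "r < N + 1" for r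
          unfolding Delta_def cmat_mat_diag mat_diag_mult_vec_index[OF v(1) that] \<delta>_def by simp
        then show ?thesis using D
          by (simp add: norm_sq_def norm_mult power_mult_distrib del: sum.lessThan_Suc)
      qed
      also have "\<dots> \<le> (\<Sum>r<N + 1. F * (cmod (v $ r))\<^sup>2)"
        by (intro sum_mono mult_right_mono \<delta>F) auto
      also have "\<dots> = F * norm_sq v"
        using v(1) by (simp add: norm_sq_def sum_distrib_left del: sum.lessThan_Suc)
      also have "\<dots> < \<gamma>\<^sup>2 * norm_sq v"
        using norm_sq_pos[OF v] F0 False by (simp add: \<gamma>_def)
      finally show ?thesis .
    qed
    have "cmat (M + ?D) = cmat M + cmat ?D" using M D by (intro eq_matI) auto
    with z have "eigenvalue (cmat M + cmat ?D) z" by simp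
    then show ?thesis
      using M D F0 by (intro no_unstable_eigenvalue_if_perturbation_below_sigma_min
          [OF _ _ Mstable _ \<gamma>_le small]) (auto simp: \<gamma>_def)
  qed
  then show ?thesis using M D unfolding stable_mat_def M_def[symmetric] by auto
qed

end
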